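(* Let $X,Y$ be indeterminates and let $L_n(x;X,Y)$ be the monic polynomials defined by $L_{-1}=0$, $L_0=1$ and $L_{n+1}(x;X,Y)=(x-b_n)L_n(x;X,Y)-\lambda_nL_{n-1}(x;X,Y)$ for $n\ge 0$, where $b_n=2n+X+Y$ and $\lambda_n=(n+X)(n+Y-1)$. Then for every non-negative integer $n$, \[ L_n(x;X,Y)=\sum_{k=0}^n (X+k+1)_{n-k}\binom{n}{k}\, {}_3F_2\!\left(\begin{matrix}k-n,\ k+1,\ Y-1\\ -n,\ X+k+1\end{matrix};1\right)(-1)^{n-k}x^k . \]
   Context: $(a)_m=a(a+1)\cdots(a+m-1)$ with $(a)_0=1$. ${}_3F_2\!\left(\begin{matrix}a_1,a_2,a_3\\ b_1,b_2\end{matrix};z\right)=\sum_{j\ge0}\frac{(a_1)_j(a_2)_j(a_3)_j}{(b_1)_j(b_2)_j\,j!}z^j$; here the series terminates at $j=n-k$ because of the numerator parameter $k-n$. *)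

theory Defs
  imports
    "HOL-Computational_Algebra.Computational_Algebra"
    "HOL-Library.Groups_Big_Fun"
begin

text \<open>
  The rational function field in two indeterminates over a field of characteristic zero is
  the fraction field of the iterated polynomial ring: the inner polynomial
  variable is \<open>X\<close>, the outer one is \<open>Y\<close>.
\<close>

type_synonym 'k ratfun2 = "'k poly poly fract"

definition indet_X :: "'k::field_char_0 ratfun2" where
  "indet_X = to_fract [:[:0, 1:]:]"

definition indet_Y :: "'k::field_char_0 ratfun2" where
  "indet_Y = to_fract [:0, 1:]"

definition b_coeff :: "'a::comm_ring_1 \<Rightarrow> 'a \<Rightarrow> nat \<Rightarrow> 'a" where
  "b_coeff X Y n = 2 * of_nat n + X + Y"

definition lambda_coeff :: "'a::comm_ring_1 \<Rightarrow> 'a \<Rightarrow> nat \<Rightarrow> 'a" where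
  "lambda_coeff X Y n = (of_nat n + X) * (of_nat n + Y - 1)"

text \<open>
  Polynomials in \<open>x\<close> with coefficients in the ring containing \<open>X\<close> and \<open>Y\<close>; \<open>[:- b, 1:]\<close> is
  \<open>x - b\<close>. The second equation is the recurrence at \<open>n = 0\<close> with \<open>L\<^bsub>-1\<^esub> = 0\<close>.
\<close>

fun L_poly :: "'a::comm_ring_1 \<Rightarrow> 'a \<Rightarrow> nat \<Rightarrow> 'a poly" where
  "L_poly X Y 0 = 1"
| "L_poly X Y (Suc 0) =
     [:- b_coeff X Y 0, 1:] * L_poly X Y 0 - smult (lambda_coeff X Y 0) 0"
| "L_poly X Y (Suc (Suc n)) =
     [:- b_coeff X Y (Suc n), 1:] * L_poly X Y (Suc n)
       - smult (lambda_coeff X Y (Suc n)) (L_poly X Y n)"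

text \<open>
  The sum over all \<open>j \<ge> 0\<close> is the library's sum of a finitely supported family, so
  this is the hypergeometric series whenever it terminates. If a numerator parameter is
  \<open>-m\<close>, all terms with \<open>j > m\<close> vanish; this includes the terms in which a denominator
  parameter \<open>-n\<close> with \<open>n \<ge> m\<close> also produces a zero factor, because \<open>0 / 0 = 0\<close>.
\<close>

definition hyp3F2 :: "'a::field \<Rightarrow> 'a \<Rightarrow> 'a \<Rightarrow> 'a \<Rightarrow> 'a \<Rightarrow> 'a \<Rightarrow> 'a" where
  "hyp3F2 a1 a2 a3 b1 b2 z =
     Sum_any (\<lambda>j::nat. pochhammer a1 j * pochhammer a2 j * pochhammer a3 j
        / (pochhammer b1 j * pochhammer b2 j * of_nat (fact j)) * z ^ j)"

lemma hyp3F2_terminating: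
  "hyp3F2 (- of_nat m) a2 a3 b1 b2 z =
     (\<Sum>j\<le>m. pochhammer (- of_nat m) j * pochhammer a2 j * pochhammer a3 j
        / (pochhammer b1 j * pochhammer b2 j * of_nat (fact j)) * z ^ j)"
  unfolding hyp3F2_def
proof (rule Sum_any.expand_superset)
  show "{j. pochhammer (- of_nat m) j * pochhammer a2 j * pochhammer a3 j
        / (pochhammer b1 j * pochhammer b2 j * of_nat (fact j)) * z ^ j \<noteq> 0} \<subseteq> {..m}"
    by (auto simp: pochhammer_of_nat_eq_0_lemma intro: leI)
qed simp

end

theory Submission
  imports Defs
begin

text \<open>
  After cancelling the denominators, the coefficient of \<open>x\<^sup>k\<close> in \<open>(-1)\<^sup>n\<^sup>-\<^sup>k L\<^sub>n\<close> is claimed to be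
  \<open>\<Sum>\<^sub>j (n-j choose k) (k+j choose k) (Y-1)\<^sub>j (X+k+1+j)\<^sub>n\<^sub>-\<^sub>k\<^sub>-\<^sub>j\<close>. Inserting this into the three-term
  recurrence, the summands combine to a difference \<open>G (j+1) - G j\<close> for an explicit \<open>G\<close>, so that the
  sum over \<open>j\<close> telescopes to \<open>0\<close>.
\<close>

section \<open>Summands of the coefficients and their telescoping certificate\<close>

definition L_term :: "'a::comm_ring_1 \<Rightarrow> 'a \<Rightarrow> nat \<Rightarrow> nat \<Rightarrow> nat \<Rightarrow> 'a" where
  "L_term X Z n k j = (if j + k \<le> n
     then of_nat ((n - j) choose k) * of_nat ((k + j) choose k) * pochhammer Z j
       * pochhammer (X + of_nat (k + 1 + j)) (n - k - j)
     else 0)"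

text \<open>This is the function \<open>G\<close> of the telescoping argument. It is the negated
  summand with lower index \<open>Suc k\<close> in the second binomial, which makes it vanish at
  \<open>j = 0\<close>; the guard makes it vanish for large \<open>j\<close>.\<close>

definition L_term_cert :: "'a::comm_ring_1 \<Rightarrow> 'a \<Rightarrow> nat \<Rightarrow> nat \<Rightarrow> nat \<Rightarrow> 'a" where
  "L_term_cert X Z n k j = (if j + k \<le> n
     then - (of_nat ((n - j) choose k) * of_nat ((k + j) choose Suc k) * pochhammer Z j
       * pochhammer (X + of_nat (k + 1 + j)) (n - k - j))
     else 0)"

definition L_coeff :: "'a::comm_ring_1 \<Rightarrow> 'a \<Rightarrow> nat \<Rightarrow> nat \<Rightarrow> 'a" where
  "L_coeff X Z n k = (\<Sum>j\<le>n. L_term X Z n k j)"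

text \<open>The guard \<open>j + k \<le> n\<close> confines the support, also for
  \<open>k = 0\<close> and \<open>j > n\<close>, where truncated subtraction would leave the
  binomial equal to 1. Sums for different \<open>n\<close> and \<open>k\<close> can thus share one
  range.\<close>

lemma L_coeff_eq_sum:
  assumes "n \<le> N + k"
  shows "L_coeff X Z n k = (\<Sum>j\<le>N. L_term X Z n k j)"
proof -
  have "L_coeff X Z n k = (\<Sum>j\<in>{j. j + k \<le> n}. L_term X Z n k j)"
    unfolding L_coeff_def by (rule sum.mono_neutral_right) (auto simp: L_term_def)
  also have "\<dots> = (\<Sum>j\<le>N. L_term X Z n k j)"
    using assms by (intro sum.mono_neutral_left) (auto simp: L_term_def)
  finally show ?thesis .
qed

lemma L_coeff_eq_0: "n < k \<Longrightarrow> L_coeff X Z n k = 0"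
  by (auto simp: L_coeff_def L_term_def intro!: sum.neutral)

lemma L_term_telescope:
  fixes X Z :: "'a::comm_ring_1"
  shows "L_term X Z (Suc (Suc m)) (Suc k) j - L_term X Z (Suc m) k j
     - (2 * of_nat (Suc m) + 1 + X + Z) * L_term X Z (Suc m) (Suc k) j
     + (of_nat (Suc m) + X) * (of_nat (Suc m) + Z) * L_term X Z m (Suc k) j
   = L_term_cert X Z (Suc m) k (Suc j) - L_term_cert X Z (Suc m) k j"
   (is "?lhs = ?rhs")
proof -
  define B where "B = (of_nat ((k + j) choose k) :: 'a)"
  define D where "D = (of_nat ((k + j) choose Suc k) :: 'a)"
  \<comment> \<open>Pascal's rule: \<open>B\<close> occurs in the summand at \<open>k\<close>,
    \<open>D\<close> in the certificate at \<open>j\<close>, and \<open>B + D\<close> in the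
    summands at \<open>Suc k\<close> and in the certificate at \<open>Suc j\<close>.\<close>
  have A: "of_nat ((Suc k + j) choose Suc k) = B + D"
    by (simp add: B_def D_def)
  \<comment> \<open>The cases follow the guards: everything vanishes; only the terms that reach
    \<open>j + k = m + 1\<close> survive; all but the summand for \<open>m\<close> survive; all six
    are present, with \<open>r\<close> the remaining slack.\<close>
  consider "m + 1 < j + k" | "j + k = m + 1" | "j + k = m" | r where "m = j + Suc k + r"
    by (metis add.assoc add_Suc_right add_Suc_shift less_iff_Suc_add linorder_neqE_nat
        not_less_eq Suc_eq_plus1)
  then show ?thesis
  proof cases
    case 1
    then show ?thesis by (simp add: L_term_def L_term_cert_def)
  next
    case 2
    then have "Suc m - j = k" "Suc (Suc m) - j = Suc k" by simp_all
    with 2 show ?thesis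
      by (simp add: L_term_def L_term_cert_def algebra_simps)
  next
    case 3
    then have m: "m = j + k" by simp
    have e: "Suc m - j = Suc k" "Suc (Suc m) - j = Suc (Suc k)" "m - j = k"
      using m by simp_all
    have "L_term X Z (Suc (Suc m)) (Suc k) j
        = of_nat (k + 2) * (B + D) * pochhammer Z j * (X + of_nat (k + 2 + j))"
      using e by (simp add: L_term_def m A[symmetric] del: binomial_Suc_Suc)
    moreover have "L_term X Z (Suc m) k j
        = of_nat (k + 1) * B * pochhammer Z j * (X + of_nat (k + 1 + j))"
      using e by (simp add: L_term_def m B_def del: binomial_Suc_Suc)
    moreover have "L_term X Z (Suc m) (Suc k) j = (B + D) * pochhammer Z j"
      using e by (simp add: L_term_def m A[symmetric] del: binomial_Suc_Suc)
    moreover have "L_term X Z m (Suc k) j = 0"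
      by (simp add: L_term_def m)
    moreover have "L_term_cert X Z (Suc m) k (Suc j)
        = - ((B + D) * pochhammer Z j * (Z + of_nat j))"
      using e by (simp add: L_term_cert_def m A[symmetric] pochhammer_Suc algebra_simps
        del: binomial_Suc_Suc)
    moreover have "L_term_cert X Z (Suc m) k j
        = - (of_nat (k + 1) * D * pochhammer Z j * (X + of_nat (k + 1 + j)))"
      using e by (simp add: L_term_cert_def m D_def del: binomial_Suc_Suc)
    ultimately show ?thesis
      by (simp only: of_nat_add of_nat_Suc m of_nat_numeral of_nat_1) (simp add: algebra_simps)
  next
    case 4
    define q where "q = Suc k + r"
    define u where "u = (of_nat (q choose Suc k) :: 'a)"
    define v where "v = (of_nat (q choose k) :: 'a)"
    define w where "w = (of_nat (Suc q choose k) :: 'a)"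
    \<comment> \<open>The Pochhammer factor common to all six terms; each of them is
      \<open>P\<close> times at most two boundary factors.\<close>
    define P where "P = pochhammer (X + of_nat (k + 2 + j)) r"
    have e: "Suc m - j = Suc q" "Suc (Suc m) - j = Suc (Suc q)" "m - j = q"
      using 4 by (simp_all add: q_def)
    have l: "Suc m - k - j = Suc (Suc r)"
      using 4 by simp
    have Pq: "pochhammer (X + of_nat (k + 1 + j)) (Suc (Suc r))
        = (X + of_nat (k + 1 + j)) * P * (X + of_nat (k + 2 + j + r))"
      by (simp only: pochhammer_Suc[of _ "Suc r"] pochhammer_rec[of _ r] P_def)
        (simp add: add_ac)
    have u1: "of_nat (Suc q choose Suc k) = u + v"
      by (simp add: u_def v_def)
    have u2: "of_nat (Suc (Suc q) choose Suc k) = u + v + w"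
      using u1 by (simp add: w_def del: binomial_Suc_Suc add: binomial_Suc_Suc[of "Suc q"])
    \<comment> \<open>Absorption is the only binomial relation needed besides Pascal's rule; here
      \<open>Suc q - k = r + 2\<close> and \<open>Suc q = k + r + 2\<close>.\<close>
    have "(Suc q - k) * (Suc q choose k) = Suc q * (q choose k)"
      using binomial_absorb_comp[of "Suc q" k] by simp
    then have "(of_nat ((r + 2) * (Suc q choose k)) :: 'a) = of_nat ((k + r + 2) * (q choose k))"
      by (simp add: q_def)
    then have rel: "of_nat (r + 2) * w = of_nat (k + r + 2) * v"
      by (simp only: of_nat_mult w_def v_def)
    have "L_term X Z (Suc (Suc m)) (Suc k) j
        = (u + v + w) * (B + D) * pochhammer Z j
          * (P * (X + of_nat (k + 2 + j + r)) * (X + of_nat (k + 3 + j + r)))"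
      unfolding L_term_def e u2 A using 4 by (simp add: P_def pochhammer_Suc add_ac)
    moreover have "L_term X Z (Suc m) k j
        = w * B * pochhammer Z j * ((X + of_nat (k + 1 + j)) * P * (X + of_nat (k + 2 + j + r)))"
      unfolding L_term_def e l B_def[symmetric] w_def[symmetric] Pq using 4 by simp
    moreover have "L_term X Z (Suc m) (Suc k) j
        = (u + v) * (B + D) * pochhammer Z j * (P * (X + of_nat (k + 2 + j + r)))"
      using e u1 A 4 by (simp add: L_term_def P_def pochhammer_Suc add_ac del: binomial_Suc_Suc)
    moreover have "L_term X Z m (Suc k) j = u * (B + D) * pochhammer Z j * P"
      using e A 4 by (simp add: L_term_def P_def u_def add_ac del: binomial_Suc_Suc)
    moreover have "L_term_cert X Z (Suc m) k (Suc j)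
        = - (v * (B + D) * (pochhammer Z j * (Z + of_nat j)) * (P * (X + of_nat (k + 2 + j + r))))"
      using e A 4 by (simp add: L_term_cert_def P_def v_def pochhammer_Suc add_ac
        del: binomial_Suc_Suc)
    moreover have "L_term_cert X Z (Suc m) k j
        = - (w * D * pochhammer Z j
            * ((X + of_nat (k + 1 + j)) * P * (X + of_nat (k + 2 + j + r))))"
      unfolding L_term_cert_def e l D_def[symmetric] w_def[symmetric] Pq using 4 by simp
    moreover have mm: "of_nat m = of_nat j + of_nat k + of_nat r + (1::'a)"
      using 4 by simp
    \<comment> \<open>Since \<open>m + 1 = k + 2 + j + r\<close>, the factor
      \<open>of_nat (Suc m) + X\<close> supplies the common boundary factor in the summand for
      \<open>m\<close>. The contributions of \<open>u\<close> then cancel, and those of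
      \<open>v\<close> and \<open>w\<close> form the absorption relation.\<close>
    ultimately have "?lhs - ?rhs = pochhammer Z j * P * (X + of_nat (k + 2 + j + r)) * (B + D)
        * (of_nat (r + 2) * w - of_nat (k + r + 2) * v)"
      by (simp only: of_nat_add of_nat_Suc mm of_nat_numeral of_nat_1) (simp add: algebra_simps)
    then show ?thesis
      using rel by simp
  qed
qed

section \<open>Three-term recurrence for the coefficients\<close>

lemma L_coeff_0_Suc:
  "L_coeff X Z (Suc n) 0 = (X + of_nat (Suc n)) * L_coeff X Z n 0 + pochhammer Z (Suc n)"
proof -
  have "L_term X Z (Suc n) 0 j = (X + of_nat (Suc n)) * L_term X Z n 0 j" if "j \<le> n" for j
    using that by (simp add: L_term_def Suc_diff_le pochhammer_Suc algebra_simps of_nat_diff)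
  then show ?thesis
    by (simp add: L_coeff_def sum_distrib_left L_term_def)
qed

text \<open>The telescoping identity covers only positive degrees. For the constant coefficient, two
  consecutive first-order recurrences are combined, and \<open>pochhammer Z (Suc (Suc m)) =
  pochhammer Z (Suc m) * (Z + of_nat (Suc m))\<close> eliminates the inhomogeneous terms.\<close>

lemma L_coeff_rec_0:
  "L_coeff X Z (Suc (Suc m)) 0 =
     (2 * of_nat (Suc m) + 1 + X + Z) * L_coeff X Z (Suc m) 0
     - (of_nat (Suc m) + X) * (of_nat (Suc m) + Z) * L_coeff X Z m 0"
  by (simp add: L_coeff_0_Suc pochhammer_Suc algebra_simps)

lemma L_coeff_rec_Suc:
  "L_coeff X Z (Suc (Suc m)) (Suc k) = L_coeff X Z (Suc m) k
     + (2 * of_nat (Suc m) + 1 + X + Z) * L_coeff X Z (Suc m) (Suc k)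
     - (of_nat (Suc m) + X) * (of_nat (Suc m) + Z) * L_coeff X Z m (Suc k)"
proof -
  let ?G = "L_term_cert X Z (Suc m) k"
  have "(\<Sum>j\<le>Suc m. ?G (Suc j) - ?G j) = ?G (Suc (Suc m)) - ?G 0"
    using sum_lessThan_telescope[of ?G "Suc (Suc m)"] by (simp only: lessThan_Suc_atMost)
  \<comment> \<open>The upper end lies outside the guard, and at \<open>j = 0\<close> the factor
    \<open>k choose Suc k\<close> is zero.\<close>
  also have "\<dots> = 0"
    by (simp add: L_term_cert_def binomial_eq_0)
  finally have "(\<Sum>j\<le>Suc m. L_term X Z (Suc (Suc m)) (Suc k) j - L_term X Z (Suc m) k j
     - (2 * of_nat (Suc m) + 1 + X + Z) * L_term X Z (Suc m) (Suc k) j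
     + (of_nat (Suc m) + X) * (of_nat (Suc m) + Z) * L_term X Z m (Suc k) j) = 0"
    by (simp only: L_term_telescope)
  then have "L_coeff X Z (Suc (Suc m)) (Suc k) - L_coeff X Z (Suc m) k
     - (2 * of_nat (Suc m) + 1 + X + Z) * L_coeff X Z (Suc m) (Suc k)
     + (of_nat (Suc m) + X) * (of_nat (Suc m) + Z) * L_coeff X Z m (Suc k) = 0"
    by (simp add: L_coeff_eq_sum[where N = "Suc m"] sum.distrib sum_subtractf sum_distrib_left
        del: sum.atMost_Suc of_nat_Suc)
  then show ?thesis
    by (simp add: algebra_simps del: of_nat_Suc)
qed

text \<open>Both sides satisfy the same recurrence once \<open>Z = Y - 1\<close> is substituted. The
  exponent \<open>n + k\<close> avoids truncated subtraction, so that \<open>k\<close> may exceed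
  \<open>n\<close>.\<close>

lemma coeff_L_poly:
  "coeff (L_poly X Y n) k = (- 1) ^ (n + k) * L_coeff X (Y - 1) n k"
proof (induction X Y n arbitrary: k rule: L_poly.induct)
  case (1 X Y)
  then show ?case
    by (cases k) (simp_all add: L_coeff_def L_term_def)
next
  case (2 X Y)
  consider "k = 0" | "k = 1" | "1 < k" by linarith
  then show ?case
    by cases (auto simp: L_coeff_def L_term_def b_coeff_def coeff_pCons split: nat.splits)
next
  case (3 X Y n)
  have b: "b_coeff X Y (Suc n) = 2 * of_nat (Suc n) + 1 + X + (Y - 1)"
    by (simp add: b_coeff_def)
  have l: "lambda_coeff X Y (Suc n) = (of_nat (Suc n) + X) * (of_nat (Suc n) + (Y - 1))"
    by (simp add: lambda_coeff_def)
  show ?case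
  proof (cases k)
    case 0
    have "coeff (L_poly X Y (Suc (Suc n))) 0 = - b_coeff X Y (Suc n) * coeff (L_poly X Y (Suc n)) 0
        - lambda_coeff X Y (Suc n) * coeff (L_poly X Y n) 0"
      by simp
    then show ?thesis
      unfolding 0 3 L_coeff_rec_0 b[symmetric] l[symmetric] by (simp add: algebra_simps)
  next
    case (Suc i)
    have "coeff (L_poly X Y (Suc (Suc n))) (Suc i) = coeff (L_poly X Y (Suc n)) i
        - b_coeff X Y (Suc n) * coeff (L_poly X Y (Suc n)) (Suc i)
        - lambda_coeff X Y (Suc n) * coeff (L_poly X Y n) (Suc i)"
      by simp
    then show ?thesis
      unfolding Suc 3 L_coeff_rec_Suc b[symmetric] l[symmetric] by (simp add: algebra_simps)
  qed
qed

text \<open>Characteristic zero passes to the field of rational functions, so that factorials can be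
  divided by there.\<close>

instance fract :: ("{idom, ring_char_0}") field_char_0
proof
  show "inj (of_nat :: nat \<Rightarrow> 'a fract)"
    by (auto intro!: injI simp: of_nat_fract eq_fract)
qed

section \<open>Cancelling the denominators of the hypergeometric series\<close>

lemma pochhammer_minus_of_nat_fact:
  assumes "j \<le> m"
  shows "pochhammer (- of_nat m :: 'a::comm_ring_1) j * of_nat (fact (m - j))
    = (- 1) ^ j * of_nat (fact m)"
  using assms
proof (induction j)
  case (Suc j)
  then have "fact (m - j) = (m - j) * fact (m - Suc j)"
    by (metis Suc_diff_Suc Suc_le_eq fact_Suc of_nat_id)
  with Suc show ?case
    by (simp add: pochhammer_Suc of_nat_diff algebra_simps)
qed simp

text \<open>The Pochhammer symbols with integer parameters become quotients of factorials, whose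
  signs cancel and which regroup into the two binomials. The prefactor splits at \<open>j\<close>,
  and its first part cancels against the nonzero denominator.\<close>

lemma hyp3F2_summand:
  fixes X Z :: "'a::field_char_0"
  assumes "j + k \<le> n" and nz: "pochhammer (X + of_nat k + 1) j \<noteq> 0"
  shows "pochhammer (X + of_nat k + 1) (n - k) * of_nat (n choose k) *
     (pochhammer (- of_nat (n - k)) j * pochhammer (of_nat k + 1) j * pochhammer Z j
      / (pochhammer (- of_nat n) j * pochhammer (X + of_nat k + 1) j * of_nat (fact j)))
    = L_term X Z n k j"
proof -
  have p1: "pochhammer (- of_nat (n - k) :: 'a) j = (- 1) ^ j * fact (n - k) / fact (n - k - j)"
    using pochhammer_minus_of_nat_fact[of j "n - k", where 'a = 'a] assms
    by (simp add: field_simps)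
  have p2: "pochhammer (- of_nat n :: 'a) j = (- 1) ^ j * fact n / fact (n - j)"
    using pochhammer_minus_of_nat_fact[of j n, where 'a = 'a] assms
    by (simp add: field_simps)
  have p3: "pochhammer (of_nat k + 1 :: 'a) j = fact (k + j) / fact k"
    using pochhammer_product'[of "1::'a" k j]
    by (simp add: pochhammer_fact[symmetric] field_simps)
  have p4: "pochhammer (X + of_nat k + 1) (n - k)
      = pochhammer (X + of_nat k + 1) j * pochhammer (X + of_nat (k + 1 + j)) (n - k - j)"
    using pochhammer_product[of j "n - k" "X + of_nat k + 1"] assms by (simp add: add_ac)
  have b1: "of_nat (n choose k) = (fact n / (fact k * fact (n - k)) :: 'a)"
    using assms by (simp add: binomial_fact)
  have b2: "of_nat ((n - j) choose k) = (fact (n - j) / (fact k * fact (n - k - j)) :: 'a)"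
    using assms by (subst binomial_fact) (simp_all add: add.commute)
  have b3: "of_nat ((k + j) choose k) = (fact (k + j) / (fact k * fact j) :: 'a)"
    by (subst binomial_fact) simp_all
  show ?thesis
    using assms unfolding L_term_def p1 p2 p3 p4 b1 b2 b3 by (simp add: mult_ac del: diff_diff_left)
qed

lemma pochhammer_hyp3F2_eq_L_coeff:
  fixes X Z :: "'a::field_char_0"
  assumes "k \<le> n" and "\<And>j. pochhammer (X + of_nat k + 1) j \<noteq> 0"
  shows "pochhammer (X + of_nat k + 1) (n - k) * of_nat (n choose k) *
     hyp3F2 (of_nat k - of_nat n) (of_nat k + 1) Z (- of_nat n) (X + of_nat k + 1) 1
    = L_coeff X Z n k"
proof -
  \<comment> \<open>Only in this form is the first parameter visibly a negated natural number, so
    that the series ends at \<open>n - k\<close>.\<close>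
  have "(of_nat k - of_nat n :: 'a) = - of_nat (n - k)"
    using assms(1) by (simp add: of_nat_diff)
  then show ?thesis
    using assms
    by (simp add: hyp3F2_terminating sum_distrib_left L_coeff_eq_sum[of n "n - k" k]
        hyp3F2_summand[symmetric] del: of_nat_diff of_nat_fact)
qed

text \<open>A zero would force \<open>X\<close> plus a natural number to vanish in the fraction
  field, hence already in the polynomial ring, where its coefficient of \<open>X\<close> is
  1.\<close>

lemma pochhammer_indet_X_nonzero:
  "pochhammer (indet_X + of_nat k + 1 :: 'k::field_char_0 ratfun2) j \<noteq> 0"
proof
  assume "pochhammer (indet_X + of_nat k + 1 :: 'k ratfun2) j = 0"
  then obtain i where "indet_X + of_nat k + 1 = (- of_nat i :: 'k ratfun2)"
    by (auto simp: pochhammer_eq_0_iff)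
  then have "indet_X + of_nat k + 1 + of_nat i = (0 :: 'k ratfun2)"
    by simp
  then have "indet_X + of_nat (k + 1 + i) = (0 :: 'k ratfun2)"
    by (simp add: add_ac)
  then have "to_fract ([:[:0, 1:]:] + of_nat (k + 1 + i)) = (0 :: 'k ratfun2)"
    by (simp only: indet_X_def to_fract_def of_nat_fract add_fract) simp
  then show False
    by (simp add: of_nat_poly)
qed

theorem theorem2p2:
  fixes n :: nat
  shows "L_poly (indet_X :: 'k::field_char_0 ratfun2) indet_Y n =
    (\<Sum>k=0..n. monom
       (pochhammer (indet_X + of_nat k + 1) (n - k) * of_nat (n choose k)
        * hyp3F2 (of_nat k - of_nat n) (of_nat k + 1) (indet_Y - 1)
            (- of_nat n) (indet_X + of_nat k + 1) 1
        * (- 1) ^ (n - k)) k)"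
proof (rule poly_eqI)
  fix i
  let ?X = "indet_X :: 'k ratfun2" and ?Z = "indet_Y - 1 :: 'k ratfun2"
  have "(\<Sum>k=0..n. monom
       (pochhammer (?X + of_nat k + 1) (n - k) * of_nat (n choose k)
        * hyp3F2 (of_nat k - of_nat n) (of_nat k + 1) ?Z (- of_nat n) (?X + of_nat k + 1) 1
        * (- 1) ^ (n - k)) k)
     = (\<Sum>k=0..n. monom (L_coeff ?X ?Z n k * (- 1) ^ (n - k)) k)"
    by (intro sum.cong refl)
      (simp add: pochhammer_hyp3F2_eq_L_coeff pochhammer_indet_X_nonzero)
  moreover have "coeff \<dots> i = (if i \<le> n then L_coeff ?X ?Z n i * (- 1) ^ (n - i) else 0)"
    by (simp add: coeff_sum)
  \<comment> \<open>The exponents \<open>n + i\<close> and \<open>n - i\<close> have the same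
    parity. For \<open>i > n\<close> both coefficients are zero.\<close>
  moreover have "(- 1 :: 'k ratfun2) ^ (n + i) = (- 1) ^ (n - i)" if "i \<le> n"
    using that by (simp add: minus_one_power_iff)
  ultimately show "coeff (L_poly ?X indet_Y n) i = coeff (\<Sum>k=0..n. monom
       (pochhammer (?X + of_nat k + 1) (n - k) * of_nat (n choose k)
        * hyp3F2 (of_nat k - of_nat n) (of_nat k + 1) ?Z (- of_nat n) (?X + of_nat k + 1) 1
        * (- 1) ^ (n - k)) k) i"
    by (simp add: coeff_L_poly L_coeff_eq_0)
qed

end
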